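(* Fix an integer $d \geq 3$. Then, as $n \to \infty$, $$(1 - o_n(1))\, \frac{1}{4ed^2} \;\leq\; \frac{H_s(n, d)\, d!}{n^{d-1}} \;\leq\; \frac{d}{d-1}.$$
   Context: For a pure simplicial complex $C$, its facets are its top-dimensional faces and its ridges are its faces of codimension one. The dual graph $G(C)$ has the facets of $C$ as vertices, two facets being adjacent if they intersect in a ridge. $C$ is strongly connected if $G(C)$ is connected, and the combinatorial diameter of $C$ is the graph diameter of $G(C)$. $H_s(n,d)$ denotes the largest combinatorial diameter of a strongly connected, pure $(d-1)$-dimensional simplicial complex on $n$ vertices. Here $e$ is Euler's number and $o_n(1)$ denotes a quantity tending to $0$ as $n\to\infty$ (with $d$ fixed). *)

theory Defs
  imports Complex_Main "Graph_Theory.Graph_Theory"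
begin

text \<open>
  Finite abstract simplicial complexes, given by their set of faces (the empty face included).
\<close>

definition abstract_simplicial_complex :: "'a set set \<Rightarrow> bool" where
  "abstract_simplicial_complex K \<longleftrightarrow>
     finite K \<and> K \<noteq> {} \<and> (\<forall>F\<in>K. finite F) \<and> (\<forall>F\<in>K. \<forall>G. G \<subseteq> F \<longrightarrow> G \<in> K)"

definition complex_vertices :: "'a set set \<Rightarrow> 'a set" where
  "complex_vertices K = {v. {v} \<in> K}"

definition face_dim :: "'a set \<Rightarrow> int" where
  "face_dim F = int (card F) - 1"

definition complex_dim :: "'a set set \<Rightarrow> int" where
  "complex_dim K = Max (face_dim ` K)"

definition facets :: "'a set set \<Rightarrow> 'a set set" where
  "facets K = {F \<in> K. face_dim F = complex_dim K}"

definition ridges :: "'a set set \<Rightarrow> 'a set set" where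
  "ridges K = {R \<in> K. face_dim R = complex_dim K - 1}"

definition pure_complex :: "'a set set \<Rightarrow> bool" where
  "pure_complex K \<longleftrightarrow>
     (\<forall>F\<in>K. (\<forall>G\<in>K. F \<subseteq> G \<longrightarrow> G = F) \<longrightarrow> face_dim F = complex_dim K)"

text \<open>
  An undirected graph is represented by the digraph with both arcs for every edge. The dual graph
  is loop-free, since a facet meets itself in a facet.
\<close>

definition dual_graph :: "'a set set \<Rightarrow> 'a set pair_pre_digraph" where
  "dual_graph K = \<lparr>pverts = facets K,
     parcs = {(F, G). F \<in> facets K \<and> G \<in> facets K \<and> F \<inter> G \<in> ridges K}\<rparr>"

definition strongly_connected_complex :: "'a set set \<Rightarrow> bool" where
  "strongly_connected_complex K \<longleftrightarrow> Digraph_Component.connected (with_proj (dual_graph K))"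

definition graph_dist :: "('a, 'b) pre_digraph \<Rightarrow> 'a \<Rightarrow> 'a \<Rightarrow> nat" where
  "graph_dist G u v = (LEAST k. \<exists>p. pre_digraph.awalk G u p v \<and> length p = k)"

text \<open>Only meaningful for finite, nonempty, connected graphs.\<close>

definition graph_diameter :: "('a, 'b) pre_digraph \<Rightarrow> nat" where
  "graph_diameter G = Max {graph_dist G u v | u v. u \<in> verts G \<and> v \<in> verts G}"

definition combinatorial_diameter :: "'a set set \<Rightarrow> nat" where
  "combinatorial_diameter K = graph_diameter (with_proj (dual_graph K))"

text \<open>
  Every finite complex is isomorphic to one whose vertices are natural numbers, so it suffices to
  range over these. The maximum is over a finite set because the diameter is less than the number
  of facets, which is at most \<open>n choose d\<close>; the set is nonempty if \<open>n \<ge> d \<ge> 2\<close>.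
\<close>

definition H_s :: "nat \<Rightarrow> nat \<Rightarrow> nat" where
  "H_s n d = Max {combinatorial_diameter K | K :: nat set set.
     abstract_simplicial_complex K \<and> pure_complex K \<and> complex_dim K = int d - 1 \<and>
     card (complex_vertices K) = n \<and> strongly_connected_complex K}"

end

theory Submission
  imports Defs
begin

text \<open>
  Upper bound: along a shortest path in the dual graph every new facet brings \<open>d - 1\<close> ridges that
  occur in no earlier facet, and there are at most \<open>n choose (d - 1)\<close> ridges.

  Lower bound: the windows of \<open>d\<close> consecutive letters of a word over the \<open>n\<close> vertices form a path in
  the dual graph, which is a shortest one if non-consecutive windows share fewer than \<open>d - 1\<close>
  letters. A last window that meets a fixed earlier one in \<open>d - 1\<close> letters can be chosen in at most
  \<open>d * n * d!\<close> ways. Hence the numbers \<open>a m\<close> of such words of length \<open>m\<close> satisfy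
  \<open>a (m + 1) \<ge> (n - 2 * d) * a m - m * d * n * d! * a (m + 1 - d)\<close>, and by induction they grow at
  least by the factor \<open>n * (1 - 1 / d)\<close> in every step as long as
  \<open>m \<le> n ^ (d - 1) / (2 * e * d\<^sup>2 * d!)\<close> and \<open>n \<ge> 4 * d\<^sup>2\<close>. Letters that are not used by the word
  are attached to the first \<open>d - 1\<close> letters, which does not shorten the path.
\<close>

subsection \<open>Distances in the dual graph\<close>

abbreviation dual_adj :: "'a set set \<Rightarrow> ('a set \<times> 'a set) set" where
  "dual_adj K \<equiv> parcs (dual_graph K)"

abbreviation admissible :: "nat \<Rightarrow> nat \<Rightarrow> nat set set \<Rightarrow> bool" where
  "admissible n d K \<equiv> abstract_simplicial_complex K \<and> pure_complex K \<and>
     complex_dim K = int d - 1 \<and> card (complex_vertices K) = n \<and> strongly_connected_complex K"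

lemma pverts_dual_graph: "pverts (dual_graph K) = facets K"
  by (simp add: dual_graph_def)

text \<open>Walks are traded for relational powers, which concatenate by \<open>relpow_add\<close>.
  The start has to be a facet because for \<open>k = 0\<close> the empty walk requires its endpoint
  to be a vertex.\<close>

lemma ex_awalk_length_iff:
  assumes "u \<in> facets K"
  shows "(\<exists>p. pre_digraph.awalk (with_proj (dual_graph K)) u p v \<and> length p = k)
    \<longleftrightarrow> (u, v) \<in> dual_adj K ^^ k"
  using assms
proof (induction k arbitrary: u)
  case 0
  then show ?case by (auto simp: pre_digraph.awalk_def pre_digraph.cas.simps dual_graph_def)
next
  case (Suc k)
  have "(\<exists>p. pre_digraph.awalk (with_proj (dual_graph K)) u p v \<and> length p = Suc k)
    \<longleftrightarrow> (\<exists>w. (u, w) \<in> dual_adj K \<and>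
      (\<exists>p. pre_digraph.awalk (with_proj (dual_graph K)) w p v \<and> length p = k))"
    (is "?L \<longleftrightarrow> ?R")
  proof
    assume ?L
    then obtain p where p: "pre_digraph.awalk (with_proj (dual_graph K)) u p v" "length p = Suc k"
      by blast
    then obtain e q where "p = e # q" by (cases p) auto
    with p show ?R
      by (intro exI[of _ "snd e"] conjI exI[of _ q])
        (auto simp: pre_digraph.awalk_def pre_digraph.cas.simps dual_graph_def)
  next
    assume ?R
    then obtain w p where "(u, w) \<in> dual_adj K"
      "pre_digraph.awalk (with_proj (dual_graph K)) w p v" "length p = k"
      by blast
    then show ?L
      using Suc.prems
      by (intro exI[of _ "(u, w) # p"]) (auto simp: pre_digraph.awalk_def pre_digraph.cas.simps dual_graph_def)
  qed
  also have "\<dots> \<longleftrightarrow> (\<exists>w. (u, w) \<in> dual_adj K \<and> (w, v) \<in> dual_adj K ^^ k)"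
    using Suc.IH by (auto simp: dual_graph_def)
  also have "\<dots> \<longleftrightarrow> (u, v) \<in> dual_adj K ^^ Suc k"
    by (metis relpow_Suc_I2 relpow_Suc_E2)
  finally show ?case .
qed

text \<open>Connectedness in the graph library is strong connectedness of the symmetrised digraph.
  As \<open>F \<inter> G = G \<inter> F\<close>, symmetrising the dual graph does not change
  reachability.\<close>

lemma strongly_connected_complex_iff:
  "strongly_connected_complex K \<longleftrightarrow>
     facets K \<noteq> {} \<and> (\<forall>F\<in>facets K. \<forall>G\<in>facets K. (F, G) \<in> (dual_adj K)\<^sup>*)"
proof -
  interpret pair_wf_digraph "dual_graph K"
    by unfold_locales (auto simp: dual_graph_def)
  have sym: "symmetric (with_proj (dual_graph K))"
    by (auto simp: symmetric_def sym_def dual_graph_def Int_commute)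
  show ?thesis
    unfolding strongly_connected_complex_def Digraph_Component.connected_def
      strongly_connected_def
    by (auto simp: reachable_mk_symmetric_eq[OF sym] reachable_conv' pverts_dual_graph)
qed

lemma graph_dist_dual_graph:
  assumes "u \<in> facets K"
  shows "graph_dist (with_proj (dual_graph K)) u v = (LEAST k. (u, v) \<in> dual_adj K ^^ k)"
  unfolding graph_dist_def ex_awalk_length_iff[OF assms] ..

lemma finite_facet_dists:
  assumes "finite K"
  shows "finite {graph_dist (with_proj (dual_graph K)) u v | u v.
    u \<in> verts (with_proj (dual_graph K)) \<and> v \<in> verts (with_proj (dual_graph K))}"
proof -
  have "finite (facets K)"
    using assms by (simp add: facets_def)
  then show ?thesis
    using finite_image_set2[of "\<lambda>u. u \<in> facets K" "\<lambda>u. u \<in> facets K"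
        "graph_dist (with_proj (dual_graph K))"]
    by (simp add: dual_graph_def)
qed

text \<open>The path is a shortest one between two facets at maximal distance. A walk of length
  \<open>k < j - i\<close> between two of its members could be spliced in and would shorten the
  whole path.\<close>

lemma combinatorial_diameter_path:
  assumes "abstract_simplicial_complex K" and "strongly_connected_complex K"
  obtains F where "\<And>i. i < combinatorial_diameter K \<Longrightarrow> (F i, F (Suc i)) \<in> dual_adj K"
    and "\<And>i j k. i + k < j \<Longrightarrow> j \<le> combinatorial_diameter K \<Longrightarrow> (F i, F j) \<notin> dual_adj K ^^ k"
proof -
  let ?L = "combinatorial_diameter K"
  let ?D = "{graph_dist (with_proj (dual_graph K)) u v | u v.
    u \<in> verts (with_proj (dual_graph K)) \<and> v \<in> verts (with_proj (dual_graph K))}"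
  have ne: "facets K \<noteq> {}" and conn: "\<And>F G. F \<in> facets K \<Longrightarrow> G \<in> facets K \<Longrightarrow> (F, G) \<in> (dual_adj K)\<^sup>*"
    using assms(2) by (auto simp: strongly_connected_complex_iff)
  have "finite ?D"
    using assms(1) finite_facet_dists by (auto simp: abstract_simplicial_complex_def)
  moreover have "?D \<noteq> {}"
    using ne by (auto simp: dual_graph_def)
  ultimately have "?L \<in> ?D"
    unfolding combinatorial_diameter_def graph_diameter_def by (rule Max_in)
  then obtain u v where u: "u \<in> facets K" and v: "v \<in> facets K"
    and "?L = graph_dist (with_proj (dual_graph K)) u v"
    by (auto simp: pverts_dual_graph)
  then have L: "?L = (LEAST k. (u, v) \<in> dual_adj K ^^ k)"
    by (simp add: graph_dist_dual_graph)
  have "\<exists>k. (u, v) \<in> dual_adj K ^^ k"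
    using conn[OF u v] by (simp add: rtrancl_power)
  then have "(u, v) \<in> dual_adj K ^^ ?L"
    unfolding L by (rule LeastI_ex)
  then obtain F where F: "F 0 = u" "F ?L = v" "\<And>i. i < ?L \<Longrightarrow> (F i, F (Suc i)) \<in> dual_adj K"
    by (auto simp: relpow_fun_conv)
  have seg: "(F i, F (i + m)) \<in> dual_adj K ^^ m" if "i + m \<le> ?L" for i m
    using that F(3) by (auto simp: relpow_fun_conv intro!: exI[of _ "\<lambda>k. F (i + k)"])
  show thesis
  proof (rule that[of F, OF F(3)])
    fix i j k assume ij: "i + k < j" "j \<le> ?L"
    show "(F i, F j) \<notin> dual_adj K ^^ k"
    proof
      assume "(F i, F j) \<in> dual_adj K ^^ k"
      moreover have "(F 0, F i) \<in> dual_adj K ^^ i" "(F j, F ?L) \<in> dual_adj K ^^ (?L - j)"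
        using seg[of 0 i] seg[of j "?L - j"] ij by auto
      ultimately have "(u, v) \<in> dual_adj K ^^ (i + k + (?L - j))"
        unfolding relpow_add F(1,2) by blast
      then have "?L \<le> i + k + (?L - j)"
        unfolding L by (rule Least_le)
      then show False using ij by linarith
    qed
  qed
qed

lemma graph_dist_le_combinatorial_diameter:
  assumes "finite K" and "u \<in> facets K" and "v \<in> facets K"
  shows "graph_dist (with_proj (dual_graph K)) u v \<le> combinatorial_diameter K"
  unfolding combinatorial_diameter_def graph_diameter_def
  using assms(2,3) by (intro Max_ge finite_facet_dists assms(1)) (auto simp: dual_graph_def)

subsection \<open>The upper bound\<close>

text \<open>
  Each facet \<open>F\<^sub>i\<close> of a shortest path contributes the \<open>d - 1\<close> ridges \<open>F\<^sub>i - {x}\<close> with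
  \<open>x \<in> F\<^sub>i\<^sub>-\<^sub>1\<close>; two facets sharing one of these would give a shortcut.
\<close>

lemma combinatorial_diameter_le_binomial:
  assumes "admissible n d K" and "d \<ge> 1"
  shows "combinatorial_diameter K * (d - 1) \<le> n choose (d - 1)"
proof -
  define L where "L = combinatorial_diameter K"
  have K: "abstract_simplicial_complex K" and dim: "complex_dim K = int d - 1"
    and n: "card (complex_vertices K) = n" and sc: "strongly_connected_complex K"
    using assms by auto
  obtain F where adj: "\<And>i. i < L \<Longrightarrow> (F i, F (Suc i)) \<in> dual_adj K"
    and short: "\<And>i j k. i + k < j \<Longrightarrow> j \<le> L \<Longrightarrow> (F i, F j) \<notin> dual_adj K ^^ k"
    using combinatorial_diameter_path[OF K sc] unfolding L_def by blast
  \<comment> \<open>Being a facet is read off an arc at \<open>F i\<close>, hence the condition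
    \<open>0 < L\<close>; at the last index the arc is the incoming one.\<close>
  have facet: "F i \<in> facets K" if "i \<le> L" "0 < L" for i
  proof (cases "i = L")
    case True
    then show ?thesis using adj[of "L - 1"] that by (simp add: dual_graph_def)
  next
    case False
    then show ?thesis using adj[of i] that by (simp add: dual_graph_def)
  qed
  have card_F: "finite (F i)" "card (F i) = d" if "i \<le> L" "0 < L" for i
    using facet[OF that] dim K
    by (auto simp: facets_def face_dim_def abstract_simplicial_complex_def)
  define A where "A i = (\<lambda>x. F i - {x}) ` (F i \<inter> F (i - 1))" for i
  have card_Int: "card (F i \<inter> F (i - 1)) = d - 1" if "i \<in> {1..L}" for i
  proof -
    have "(F (i - 1), F i) \<in> dual_adj K"
      using adj[of "i - 1"] that by (cases i) auto
    then have "int (card (F i \<inter> F (i - 1))) = int d - 1 - 1 + 1"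
      using dim by (simp add: dual_graph_def ridges_def face_dim_def Int_commute)
    then show ?thesis by linarith
  qed
  have card_A: "card (A i) = d - 1" if "i \<in> {1..L}" for i
    unfolding A_def card_Int[OF that, symmetric] by (rule card_image) (auto simp: inj_on_def)
  have A_sub: "A i \<subseteq> {R. R \<subseteq> complex_vertices K \<and> card R = d - 1}" if "i \<in> {1..L}" for i
  proof -
    have "F i \<in> K" using facet[of i] that by (auto simp: facets_def)
    then have "F i \<subseteq> complex_vertices K"
      using K by (auto simp: abstract_simplicial_complex_def complex_vertices_def)
    then show ?thesis using card_F[of i] that by (auto simp: A_def)
  qed
  \<comment> \<open>A shared ridge makes the two facets adjacent, which forces
    \<open>i = j - 1\<close>. Their intersection is then \<open>F j\<close> without its new vertex,
    whereas the members of \<open>A j\<close> omit a vertex of \<open>F (j - 1)\<close>.\<close>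
  have disj: "A i \<inter> A j = {}" if "i \<in> {1..L}" "j \<in> {1..L}" "i < j" for i j
  proof (rule ccontr)
    assume "A i \<inter> A j \<noteq> {}"
    then obtain x y where x: "x \<in> F i" and y: "y \<in> F j" "y \<in> F (j - 1)" and eq: "F i - {x} = F j - {y}"
      by (auto simp: A_def)
    have fin: "finite (F i)" "finite (F j)" and c: "card (F i) = d" "card (F j) = d"
      using card_F that by auto
    have "F i \<noteq> F j"
      using short[of i 0 j] that by auto
    with eq x y(1) have I: "F i \<inter> F j = F j - {y}" by blast
    then have "card (F i \<inter> F j) = d - 1"
      using fin c y(1) by simp
    moreover have "F i \<inter> F j \<in> K"
      using K facet[of i] that by (auto simp: abstract_simplicial_complex_def facets_def)
    ultimately have "F i \<inter> F j \<in> ridges K"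
      using dim \<open>d \<ge> 1\<close> by (simp add: ridges_def face_dim_def)
    then have "(F i, F j) \<in> dual_adj K ^^ 1"
      using facet that by (simp add: dual_graph_def)
    then have "i = j - 1"
      using short[of i 1 j] that by fastforce
    then have "F j \<subseteq> F i" using I y by auto
    then show False
      using fin c \<open>F i \<noteq> F j\<close> by (metis card_subset_eq)
  qed
  have fin_vert: "finite (complex_vertices K)"
  proof -
    have "complex_vertices K \<subseteq> \<Union>K" by (auto simp: complex_vertices_def)
    then show ?thesis
      using K by (auto simp: abstract_simplicial_complex_def intro: finite_subset)
  qed
  have "L * (d - 1) = (\<Sum>i\<in>{1..L}. card (A i))"
    using card_A by simp
  also have "\<dots> = card (\<Union>i\<in>{1..L}. A i)"
  proof (rule card_UN_disjoint[symmetric])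
    show "\<forall>i\<in>{1..L}. finite (A i)"
      using card_F by (auto simp: A_def)
    show "\<forall>i\<in>{1..L}. \<forall>j\<in>{1..L}. i \<noteq> j \<longrightarrow> A i \<inter> A j = {}"
      using disj by (metis Int_commute nat_neq_iff)
  qed simp
  also have "\<dots> \<le> card {R. R \<subseteq> complex_vertices K \<and> card R = d - 1}"
    using fin_vert by (intro card_mono UN_least A_sub) auto
  also have "\<dots> = n choose (d - 1)"
    using n_subsets[OF fin_vert] n by simp
  finally show ?thesis unfolding L_def .
qed

subsection \<open>Complexes from sparse words\<close>

text \<open>All generating sets have the same size, so none contains another and they are exactly
  the maximal faces of the down-closure. Stating adjacency over the integers avoids truncated
  subtraction at \<open>d = 0\<close>.\<close>

lemma complex_of_facets:
  fixes S :: "'a set set"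
  assumes "finite S" and "S \<noteq> {}" and "\<forall>F\<in>S. finite F \<and> card F = d"
  defines "K \<equiv> {G. \<exists>F\<in>S. G \<subseteq> F}"
  shows "abstract_simplicial_complex K" and "pure_complex K" and "complex_dim K = int d - 1"
    and "complex_vertices K = \<Union>S"
    and "dual_adj K = {(F, G). F \<in> S \<and> G \<in> S \<and> int (card (F \<inter> G)) = int d - 1}"
    and "facets K = S"
proof -
  have S: "finite F \<and> card F = d" if "F \<in> S" for F
    using assms(3) that by blast
  have fin: "finite K"
  proof -
    have "K = (\<Union>F\<in>S. Pow F)" by (auto simp: K_def)
    then show ?thesis using assms by simp
  qed
  show asc: "abstract_simplicial_complex K"
    using fin assms(2) S by (auto simp: abstract_simplicial_complex_def K_def intro: finite_subset)
  show dim: "complex_dim K = int d - 1"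
    unfolding complex_dim_def
  proof (rule Max_eqI)
    show "finite (face_dim ` K)" using fin by simp
    show "y \<le> int d - 1" if "y \<in> face_dim ` K" for y
    proof -
      obtain F G where "F \<in> S" "G \<subseteq> F" "y = face_dim G"
        using \<open>y \<in> face_dim ` K\<close> by (auto simp: K_def)
      then show ?thesis
        using S[of F] card_mono[of F G] by (simp add: face_dim_def)
    qed
    obtain F where "F \<in> S" using assms(2) by blast
    then show "int d - 1 \<in> face_dim ` K"
      using S by (intro image_eqI[of _ _ F]) (auto simp: face_dim_def K_def)
  qed
  show "pure_complex K"
    unfolding pure_complex_def dim using S by (auto simp: K_def face_dim_def)
  show "complex_vertices K = \<Union>S"
    by (auto simp: complex_vertices_def K_def)
  show facets: "facets K = S"
  proof
    show "facets K \<subseteq> S"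
    proof
      fix G assume G: "G \<in> facets K"
      then obtain F where "F \<in> S" "G \<subseteq> F" by (auto simp: facets_def K_def)
      moreover have "card G = d" using G dim by (auto simp: facets_def face_dim_def)
      ultimately show "G \<in> S" using S card_subset_eq by metis
    qed
    show "S \<subseteq> facets K"
      unfolding facets_def dim using S by (auto simp: K_def face_dim_def)
  qed
  show "dual_adj K = {(F, G). F \<in> S \<and> G \<in> S \<and> int (card (F \<inter> G)) = int d - 1}"
    unfolding dual_graph_def facets ridges_def dim by (auto simp: face_dim_def K_def)
qed

text \<open>A potential that rises by at most one per step certifies a lower bound on
  distances.\<close>

lemma relpow_potential_le:
  fixes f :: "'a \<Rightarrow> nat"
  assumes "\<And>x y. (x, y) \<in> R \<Longrightarrow> f y \<le> f x + 1" and "(u, v) \<in> R ^^ k"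
  shows "f v \<le> f u + k"
  using assms(2)
proof (induction k arbitrary: v)
  case (Suc k)
  then obtain w where "(u, w) \<in> R ^^ k" "(w, v) \<in> R" by auto
  then show ?case using Suc.IH[of w] assms(1)[of w v] by linarith
qed simp

text \<open>Windows are sets because they become facets. They are meaningful for
  \<open>i + d \<le> length w\<close> only.\<close>

definition window :: "nat \<Rightarrow> 'a list \<Rightarrow> nat \<Rightarrow> 'a set" where
  "window d w i = (!) w ` {i..<i + d}"

text \<open>
  Letters at distance less than \<open>2 * d\<close> differ, so windows that overlap in position meet only in
  their common positions; the second condition is needed only for windows in disjoint positions.
\<close>

definition sparse_word :: "nat \<Rightarrow> 'a list \<Rightarrow> bool" where
  "sparse_word d w \<longleftrightarrow>
     (\<forall>i j. i < j \<and> j < length w \<and> j < i + 2 * d \<longrightarrow> w ! i \<noteq> w ! j) \<and>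
     (\<forall>i j. i + d \<le> j \<and> j + d \<le> length w \<longrightarrow> card (window d w i \<inter> window d w j) < d - 1)"

lemma finite_window [simp]: "finite (window d w i)"
  by (simp add: window_def)

lemma inj_on_nth_sparse_word:
  assumes "sparse_word d w" and "j \<le> i + 2 * d" and "j \<le> length w"
  shows "inj_on ((!) w) {i..<j}"
proof (rule linorder_inj_onI)
  fix a b assume "a < b" "a \<in> {i..<j}" "b \<in> {i..<j}"
  then show "w ! a \<noteq> w ! b"
    using assms unfolding sparse_word_def by auto
qed auto

lemma card_window:
  assumes "sparse_word d w" and "i + d \<le> length w"
  shows "card (window d w i) = d"
  using inj_on_nth_sparse_word[OF assms(1) _ assms(2), of i]
  by (simp add: window_def card_image)

text \<open>Both windows lie within at most \<open>2 * d\<close> consecutive positions, on which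
  \<open>(!) w\<close> is injective, so the intersection can be taken on positions.\<close>

lemma card_window_Int_near:
  assumes "sparse_word d w" and "i \<le> j" and "j \<le> i + d" and "j + d \<le> length w"
  shows "card (window d w i \<inter> window d w j) = i + d - j"
proof -
  have inj: "inj_on ((!) w) {i..<j + d}"
    using assms by (intro inj_on_nth_sparse_word[of d]) auto
  have "window d w i \<inter> window d w j = (!) w ` ({i..<i + d} \<inter> {j..<j + d})"
    unfolding window_def using assms
    by (intro inj_on_image_Int[OF inj, symmetric]) auto
  also have "{i..<i + d} \<inter> {j..<j + d} = {j..<i + d}"
    using assms by auto
  also have "card ((!) w ` {j..<i + d}) = i + d - j"
    using inj_on_subset[OF inj, of "{j..<i + d}"] assms by (simp add: card_image)
  finally show ?thesis .
qed

lemma card_window_Int_less: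
  assumes "sparse_word d w" and "d \<ge> 2" and "i + 2 \<le> j" and "j + d \<le> length w"
  shows "card (window d w i \<inter> window d w j) < d - 1"
proof (cases "j < i + d")
  case True
  then show ?thesis using card_window_Int_near[of d w i j] assms by simp
next
  case False
  then show ?thesis using assms by (simp add: sparse_word_def)
qed

text \<open>This makes the position of a window a function of the window, as the potential in the
  distance bound requires.\<close>

lemma inj_on_window:
  assumes "sparse_word d w" and "d \<ge> 2" and "d \<le> length w"
  shows "inj_on (window d w) {..length w - d}"
proof (rule linorder_inj_onI)
  fix i j assume ij: "i < j" "i \<in> {..length w - d}" "j \<in> {..length w - d}"
  have "card (window d w i \<inter> window d w j) < d"
  proof (cases "j = Suc i")
    case True
    then show ?thesis using card_window_Int_near[of d w i j] assms ij by auto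
  next
    case False
    then show ?thesis using card_window_Int_less[of d w i j] assms ij by (simp; linarith)
  qed
  moreover have "card (window d w i) = d"
    using card_window[of d w i] assms ij by simp
  ultimately show "window d w i \<noteq> window d w j" by auto
qed auto

text \<open>The potential is the position of a window, and 0 on the attached facets
  \<open>insert u R\<close>. It rises by at most one along arcs: windows two or more positions apart
  share too few letters, and an attached facet meets any window only inside \<open>R\<close>, hence
  inside window \<open>0\<close>.\<close>

lemma sparse_word_diameter:
  fixes w :: "nat list"
  assumes w: "sparse_word d w" and d: "d \<ge> 2" and len: "d \<le> length w" and sub: "set w \<subseteq> {..<n}"
  shows "\<exists>K. admissible n d K \<and> length w - d \<le> combinatorial_diameter K"
proof -
  define N where "N = length w - d"
  define R where "R = (!) w ` {0..<d - 1}"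
  define U where "U = {..<n} - set w"
  define S where "S = window d w ` {..N} \<union> (\<lambda>u. insert u R) ` U"
  define K where "K = {G. \<exists>F\<in>S. G \<subseteq> F}"
  have N: "i \<le> N \<longleftrightarrow> i + d \<le> length w" for i
    using len by (auto simp: N_def)
  have R_sub: "R \<subseteq> window d w 0" "R \<subseteq> set w"
    using len by (auto simp: R_def window_def)
  have R: "finite R" "card R = d - 1"
    using inj_on_nth_sparse_word[OF w, of "d - 1" 0] len by (auto simp: R_def card_image)
  have win_sub: "window d w i \<subseteq> set w" if "i \<le> N" for i
    using that by (auto simp: window_def N)
  have cardS: "finite F \<and> card F = d" if "F \<in> S" for F
  proof -
    have "card (insert u R) = d" if "u \<in> U" for u
      using that R R_sub d by (subst card_insert_disjoint) (auto simp: U_def)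
    then show ?thesis
      using that R card_window[OF w] by (auto simp: S_def N)
  qed
  have finS: "finite S" and neS: "S \<noteq> {}"
    by (auto simp: S_def U_def)
  have "\<forall>F\<in>S. finite F \<and> card F = d"
    using cardS by blast
  note K = complex_of_facets[OF finS neS this, folded K_def]
  have vertices: "complex_vertices K = {..<n}"
    unfolding K(4)
  proof
    show "\<Union>S \<subseteq> {..<n}"
      using win_sub R_sub sub by (force simp: S_def U_def)
    show "{..<n} \<subseteq> \<Union>S"
    proof
      fix x assume x: "x \<in> {..<n}"
      show "x \<in> \<Union>S"
      proof (cases "x \<in> set w")
        case True
        then obtain k where k: "k < length w" "x = w ! k" by (auto simp: in_set_conv_nth)
        \<comment> \<open>The window starting at \<open>k\<close> is used if it fits, and otherwise
          the last one, which covers all positions from \<open>N\<close> on.\<close>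
        have "x \<in> window d w (min k N)"
          using k d len by (auto simp: window_def N_def)
        then show ?thesis by (auto simp: S_def)
      next
        case False
        with x have "insert x R \<in> S" by (auto simp: S_def U_def)
        then show ?thesis by blast
      qed
    qed
  qed
  have adj_win: "(window d w i, window d w (Suc i)) \<in> dual_adj K" if "Suc i \<le> N" for i
    using that card_window_Int_near[OF w, of i "Suc i"] d unfolding K(5)
    by (auto simp: S_def N)
  have adj_ins: "(window d w 0, insert u R) \<in> dual_adj K" if "u \<in> U" for u
  proof -
    have "u \<notin> window d w 0"
      using that win_sub[of 0] by (auto simp: U_def)
    then have "window d w 0 \<inter> insert u R = R" using R_sub by blast
    then show ?thesis unfolding K(5) using that R d by (auto simp: S_def)
  qed
  have reach: "(window d w 0, F) \<in> (dual_adj K)\<^sup>*" if "F \<in> S" for F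
  proof -
    have "(window d w 0, window d w i) \<in> (dual_adj K)\<^sup>*" if "i \<le> N" for i
      using that
    proof (induction i)
      case (Suc i)
      then show ?case using adj_win[of i] by (auto intro: rtrancl_into_rtrancl)
    qed simp
    then show ?thesis using that adj_ins by (auto simp: S_def)
  qed
  have "sym (dual_adj K)"
    unfolding K(5) by (auto simp: sym_def Int_commute)
  then have sc: "strongly_connected_complex K"
    unfolding strongly_connected_complex_iff K(6)
    using neS reach by (meson rtrancl_trans sym_rtrancl symE)
  define f where
    "f F = (if F \<in> window d w ` {..N} then the_inv_into {..N} (window d w) F else 0)" for F
  have inj: "inj_on (window d w) {..N}"
    unfolding N_def by (rule inj_on_window[OF w d len])
  have f_win: "f (window d w i) = i" if "i \<le> N" for i
    using that inj by (simp add: f_def the_inv_into_f_f)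
  have f_ins: "f (insert u R) = 0" if "u \<in> U" for u
    using that win_sub by (auto simp: f_def U_def)
  have f_step: "f G \<le> f F + 1" if FG: "(F, G) \<in> dual_adj K" for F G
  proof (rule ccontr)
    assume less: "\<not> f G \<le> f F + 1"
    have F: "F \<in> S" and G: "G \<in> S" and c: "int (card (F \<inter> G)) = int d - 1"
      using FG unfolding K(5) by auto
    \<comment> \<open>The potential of \<open>G\<close> exceeds 1, so \<open>G\<close> is not an
      attached facet.\<close>
    obtain j where j: "j \<le> N" "G = window d w j"
      using G less f_ins by (auto simp: S_def)
    have *: "card (window d w i \<inter> window d w j) < d - 1" if "i + 2 \<le> j" for i
      using card_window_Int_less[OF w d that] j by (simp add: N)
    from F consider i where "i \<le> N" "F = window d w i" | u where "u \<in> U" "F = insert u R"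
      by (auto simp: S_def)
    then show False
    proof cases
      case 1
      then show False using *[of i] less f_win j c by auto
    next
      case 2
      have "u \<notin> window d w j" using 2 win_sub[OF j(1)] by (auto simp: U_def)
      then have "F \<inter> G \<subseteq> window d w 0 \<inter> window d w j"
        using 2 j R_sub by auto
      then have "card (F \<inter> G) \<le> card (window d w 0 \<inter> window d w j)"
        by (intro card_mono) auto
      then show False using *[of 0] less f_win f_ins 2 j c by auto
    qed
  qed
  have wins: "window d w 0 \<in> facets K" "window d w N \<in> facets K"
    unfolding K(6) by (auto simp: S_def)
  have "N \<le> graph_dist (with_proj (dual_graph K)) (window d w 0) (window d w N)"
    unfolding graph_dist_dual_graph[OF wins(1)]
  proof (rule LeastI2_ex)
    show "\<exists>k. (window d w 0, window d w N) \<in> dual_adj K ^^ k"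
      using reach wins(2) unfolding K(6) by (simp add: rtrancl_power)
    show "N \<le> k" if "(window d w 0, window d w N) \<in> dual_adj K ^^ k" for k
      using relpow_potential_le[of _ f, OF f_step that] f_win by simp
  qed
  also have "\<dots> \<le> combinatorial_diameter K"
    using K(1) wins by (intro graph_dist_le_combinatorial_diameter)
      (auto simp: abstract_simplicial_complex_def)
  finally show ?thesis
    using K(1-3) sc vertices by (auto simp: N_def)
qed

subsection \<open>Counting sparse words\<close>

lemma window_append:
  assumes "i + d \<le> length p"
  shows "window d (p @ q) i = window d p i"
  unfolding window_def by (rule image_cong) (use assms in \<open>auto simp: nth_append\<close>)

lemma sparse_word_appendD:
  assumes "sparse_word d (p @ q)"
  shows "sparse_word d p"
  unfolding sparse_word_def
proof (intro conjI allI impI)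
  fix i j assume ij: "i < j \<and> j < length p \<and> j < i + 2 * d"
  then have "(p @ q) ! i \<noteq> (p @ q) ! j"
    using assms unfolding sparse_word_def by (metis length_append trans_less_add1)
  then show "p ! i \<noteq> p ! j" using ij by (simp add: nth_append)
next
  fix i j assume ij: "i + d \<le> j \<and> j + d \<le> length p"
  then have "card (window d (p @ q) i \<inter> window d (p @ q) j) < d - 1"
    using assms unfolding sparse_word_def by (metis length_append trans_le_add1)
  then show "card (window d p i \<inter> window d p j) < d - 1"
    using ij by (simp add: window_append)
qed

text \<open>The only new window starts at \<open>Suc (length v) - d\<close>. It needs to be compared
  only with windows that end before this position, since
  \<open>i + 2 * d \<le> Suc (length v)\<close> expresses disjointness of positions.\<close>

lemma sparse_word_snocI:
  assumes v: "sparse_word d v" and d: "d \<ge> 1"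
    and new: "\<And>i. i < length v \<Longrightarrow> length v < i + 2 * d \<Longrightarrow> v ! i \<noteq> c"
    and far: "\<And>i. i + 2 * d \<le> Suc (length v) \<Longrightarrow>
      card (window d v i \<inter> window d (v @ [c]) (Suc (length v) - d)) < d - 1"
  shows "sparse_word d (v @ [c])"
  unfolding sparse_word_def
proof (intro conjI allI impI)
  fix i j assume ij: "i < j \<and> j < length (v @ [c]) \<and> j < i + 2 * d"
  show "(v @ [c]) ! i \<noteq> (v @ [c]) ! j"
  proof (cases "j = length v")
    case True
    then show ?thesis using new[of i] ij by (simp add: nth_append)
  next
    case False
    then show ?thesis using v ij by (simp add: nth_append sparse_word_def)
  qed
next
  fix i j assume ij: "i + d \<le> j \<and> j + d \<le> length (v @ [c])"
  show "card (window d (v @ [c]) i \<inter> window d (v @ [c]) j) < d - 1"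
  proof (cases "j + d \<le> length v")
    case True
    then show ?thesis using v ij by (simp add: window_append sparse_word_def)
  next
    case False
    then have "j = Suc (length v) - d" using ij by (simp; linarith)
    then show ?thesis using far[of i] ij d by (simp add: window_append)
  qed
qed

text \<open>At most one letter of such a list lies outside \<open>V\<close>. Removing a suitable
  letter leaves an injective list of length \<open>d - 1\<close> over \<open>V\<close>; the list is
  recovered from this rest, the removed letter and its position.\<close>

lemma card_distinct_lists_near_set:
  assumes V: "finite V" "card V = d" and d: "d \<ge> 1"
  shows "card {q. length q = d \<and> distinct q \<and> set q \<subseteq> {..<n} \<and> d - 1 \<le> card (set q \<inter> V)}
    \<le> d * n * fact d" (is "card ?Q \<le> _")
proof -
  define T where "T = {r. length r = d - 1 \<and> distinct r \<and> set r \<subseteq> V}"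
  have "T \<subseteq> {r. set r \<subseteq> V \<and> length r = d - 1}" by (auto simp: T_def)
  then have finT: "finite T"
    using finite_lists_length_eq[OF V(1)] finite_subset by blast
  \<comment> \<open>The falling factorial from \<open>d\<close> down to 2 is already
    \<open>fact d\<close>, as the missing factor is 1.\<close>
  have "card T = \<Prod>{d - (d - 1) + 1..d}"
    unfolding T_def using card_lists_distinct_length_eq[of V "d - 1"] V by simp
  also have "\<dots> = \<Prod>{2..d}"
    using d by (intro arg_cong[of _ _ "\<lambda>A. \<Prod>A"]) auto
  also have "\<dots> = \<Prod>{1..d}"
    using prod.atLeast_Suc_atMost[OF d, of "\<lambda>x. x"] by (simp add: numeral_2_eq_2)
  also have "\<dots> = fact d"
    by (simp add: fact_prod)
  finally have cardT: "card T = fact d" .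
  have "?Q \<subseteq> (\<lambda>(k, c, r). take k r @ c # drop k r) ` ({..<d} \<times> {..<n} \<times> T)"
  proof
    fix q assume q: "q \<in> ?Q"
    have "card (set q - V) = d - card (set q \<inter> V)"
      using q by (simp add: card_Diff_subset_Int distinct_card)
    with q have "card (set q - V) \<le> 1" by auto
    moreover have "q \<noteq> []" using q d by auto
    \<comment> \<open>The removed letter is the one outside \<open>V\<close>, or the head if all
      letters lie in \<open>V\<close>.\<close>
    ultimately obtain x where x: "x \<in> set q" "set q - V \<subseteq> {x}"
    proof (cases "set q - V = {}")
      case True
      then show thesis using that[of "hd q"] \<open>q \<noteq> []\<close> by auto
    next
      case False
      then have "card (set q - V) = 1"
        using \<open>card (set q - V) \<le> 1\<close> by (simp add: card_gt_0_iff le_Suc_eq)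
      then show thesis using that by (auto simp: card_1_singleton_iff)
    qed
    then obtain ys zs where yz: "q = ys @ x # zs" by (auto dest: split_list)
    have "ys @ zs \<in> T" using q x yz by (auto simp: T_def)
    moreover have "length ys < d" "x < n" using q yz by auto
    moreover have "q = take (length ys) (ys @ zs) @ x # drop (length ys) (ys @ zs)"
      by (simp add: yz)
    ultimately show "q \<in> (\<lambda>(k, c, r). take k r @ c # drop k r) ` ({..<d} \<times> {..<n} \<times> T)"
      by (intro image_eqI[of _ _ "(length ys, x, ys @ zs)"]) auto
  qed
  then have "card ?Q \<le> card ({..<d} \<times> {..<n} \<times> T)"
    using finT by (intro surj_card_le) auto
  also have "\<dots> = d * n * fact d"
    by (simp add: card_cartesian_product cardT)
  finally show ?thesis .
qed

definition sparse_words :: "nat \<Rightarrow> nat \<Rightarrow> nat \<Rightarrow> nat list set" where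
  "sparse_words n d m = {w. length w = m \<and> set w \<subseteq> {..<n} \<and> sparse_word d w}"

lemma finite_sparse_words: "finite (sparse_words n d m)"
proof -
  have "sparse_words n d m \<subseteq> {w. set w \<subseteq> {..<n} \<and> length w = m}"
    by (auto simp: sparse_words_def)
  then show ?thesis
    using finite_lists_length_eq[of "{..<n}" m] finite_subset by blast
qed

text \<open>Union bound over the one-letter extensions \<open>E\<close> of sparse words. An
  extension fails either by repeating one of the letters just before it (\<open>B1\<close>), or
  because its last window \<open>q\<close> conflicts with an earlier window \<open>i\<close>
  (\<open>B2\<close>). In the second case it is determined by \<open>q\<close> and the sparse prefix
  \<open>p\<close> left after deleting \<open>q\<close>, with fewer than \<open>m\<close> positions
  possible for \<open>i\<close>.\<close>

lemma card_sparse_words_step: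
  assumes d: "d \<ge> 1"
  shows "n * card (sparse_words n d m) \<le> card (sparse_words n d (Suc m)) +
    2 * d * card (sparse_words n d m) +
    (if 2 * d \<le> Suc m then m * (d * n * fact d) * card (sparse_words n d (Suc m - d)) else 0)"
proof -
  let ?A = "sparse_words n d"
  define Q where "Q V = {q. length q = d \<and> distinct q \<and> set q \<subseteq> {..<n} \<and> d - 1 \<le> card (set q \<inter> V)}"
    for V
  define I where "I = {i. i + 2 * d \<le> Suc m}"
  define E where "E = (\<lambda>(v, c). v @ [c]) ` (?A m \<times> {..<n})"
  \<comment> \<open>Here \<open>k\<close> is the distance from the new position \<open>m\<close>
    back to the repeated letter.\<close>
  define B1 where "B1 = (\<lambda>(v, k). v @ [v ! (m - k)]) ` (?A m \<times> {..<2 * d})"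
  define B2 where "B2 = (\<Union>(p, i)\<in>?A (Suc m - d) \<times> I. (@) p ` Q (window d p i))"
  have finQ: "finite (Q V)" for V
    by (rule finite_subset[OF _ finite_lists_length_eq[of "{..<n}" d]]) (auto simp: Q_def)
  have finI: "finite I"
    by (rule finite_subset[of _ "{..Suc m}"]) (auto simp: I_def)
  have "E \<subseteq> ?A (Suc m) \<union> B1 \<union> B2"
  proof
    fix x assume "x \<in> E"
    then obtain v c where x: "x = v @ [c]" and v: "v \<in> ?A m" and c: "c < n"
      by (auto simp: E_def)
    have v': "length v = m" "set v \<subseteq> {..<n}" "sparse_word d v"
      using v by (auto simp: sparse_words_def)
    show "x \<in> ?A (Suc m) \<union> B1 \<union> B2"
    proof (cases "\<exists>i. i < m \<and> m < i + 2 * d \<and> v ! i = c")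
      case True
      then obtain i where i: "i < m" "m < i + 2 * d" "v ! i = c" by blast
      then have "x \<in> B1"
        unfolding B1_def x using v by (intro image_eqI[of _ _ "(v, m - i)"]) auto
      then show ?thesis by blast
    next
      case False
      then have new: "v ! i \<noteq> c" if "i < length v" "length v < i + 2 * d" for i
        using that v' by auto
      show ?thesis
      proof (cases "sparse_word d x")
        case True
        then show ?thesis using x v' c by (auto simp: sparse_words_def)
      next
        case False
        then obtain i where i: "i + 2 * d \<le> Suc m"
          and i_far: "d - 1 \<le> card (window d v i \<inter> window d x (Suc m - d))"
          using sparse_word_snocI[OF v'(3) d new] v'(1) unfolding x by (meson not_less)
        define p where "p = take (Suc m - d) x"
        define q where "q = drop (Suc m - d) x"
        have pq: "x = p @ q" by (simp add: p_def q_def)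
        have p: "p = take (Suc m - d) v"
          using v' d by (simp add: p_def x)
        have "sparse_word d p"
          using v'(3) sparse_word_appendD[of d p "drop (Suc m - d) v"] by (simp add: p)
        then have p_in: "p \<in> ?A (Suc m - d)"
          using v' d set_take_subset[of "Suc m - d" v] by (auto simp: sparse_words_def p)
        have len_q: "length q = d" using v' i by (simp add: q_def x)
        have len_p: "length p = Suc m - d" using p_in by (simp add: sparse_words_def)
        have win_q: "window d x (Suc m - d) = set q"
        proof -
          have "{Suc m - d..<Suc m - d + d} = (\<lambda>k. Suc m - d + k) ` {0..<d}"
            by (simp add: add.commute)
          then have "window d x (Suc m - d) = (\<lambda>k. x ! (Suc m - d + k)) ` {0..<d}"
            unfolding window_def by (simp only: image_image)
          also have "\<dots> = (!) q ` {0..<d}"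
            by (rule image_cong) (auto simp: pq nth_append len_p)
          also have "\<dots> = set q"
            by (simp add: nth_image len_q)
          finally show ?thesis .
        qed
        \<comment> \<open>The earlier window ends before \<open>q\<close> starts, so it is fixed by
          \<open>p\<close> alone and the choices for \<open>q\<close> can be counted against
          it.\<close>
        have win_v: "window d v i = window d p i"
          using i len_p window_append[of i d p "drop (Suc m - d) v"] by (simp add: p)
        \<comment> \<open>The word \<open>x\<close> is not sparse here: pairs of old letters differ
          by sparsity of \<open>v\<close>, and pairs with the new letter by
          \<open>new\<close>.\<close>
        have "distinct q"
        proof -
          have "inj_on ((!) x) {Suc m - d..<Suc m}"
          proof (rule linorder_inj_onI)
            fix a b assume ab: "a < b" "a \<in> {Suc m - d..<Suc m}" "b \<in> {Suc m - d..<Suc m}"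
            show "x ! a \<noteq> x ! b"
            proof (cases "b = m")
              case True
              then show ?thesis using ab new[of a] v' d i by (auto simp: x nth_append)
            next
              case False
              then show ?thesis
                using ab v' d i by (auto simp: x nth_append sparse_word_def)
            qed
          qed auto
          then have "card (window d x (Suc m - d)) = d"
            using i by (simp add: window_def card_image)
          then show ?thesis using win_q len_q card_distinct by metis
        qed
        moreover have "set q \<subseteq> {..<n}"
          using v' c set_drop_subset[of "Suc m - d" x] by (auto simp: q_def x)
        ultimately have "q \<in> Q (window d p i)"
          using len_q i_far by (auto simp: Q_def win_v win_q Int_commute)
        then have "x \<in> B2"
          using p_in i unfolding B2_def pq I_def by blast
        then show ?thesis by blast
      qed
    qed
  qed
  moreover have finB: "finite B1" "finite B2"
    using finQ finI finite_sparse_words by (auto simp: B1_def B2_def)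
  ultimately have "card E \<le> card (?A (Suc m) \<union> B1 \<union> B2)"
    using finite_sparse_words by (intro card_mono) auto
  also have "\<dots> \<le> card (?A (Suc m)) + card B1 + card B2"
    by (meson add_mono card_Un_le le_refl order_trans)
  finally have "card E \<le> card (?A (Suc m)) + card B1 + card B2" .
  moreover have "card E = n * card (?A m)"
    unfolding E_def by (subst card_image) (auto simp: inj_on_def card_cartesian_product)
  moreover have "card B1 \<le> 2 * d * card (?A m)"
    unfolding B1_def using card_image_le[of "?A m \<times> {..<2 * d}"] finite_sparse_words
    by (fastforce simp: card_cartesian_product mult.commute)
  moreover have "card B2 \<le>
    (if 2 * d \<le> Suc m then m * (d * n * fact d) * card (?A (Suc m - d)) else 0)"
  proof (cases "2 * d \<le> Suc m")
    case True
    have "card B2 \<le> (\<Sum>(p, i)\<in>?A (Suc m - d) \<times> I. card ((@) p ` Q (window d p i)))"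
      unfolding B2_def case_prod_beta
      by (intro card_UN_le finite_cartesian_product finite_sparse_words finI)
    also have "\<dots> \<le> (\<Sum>(p, i)\<in>?A (Suc m - d) \<times> I. d * n * fact d)"
    proof (rule sum_mono, clarify)
      fix p i assume p: "p \<in> ?A (Suc m - d)" and i: "i \<in> I"
      have "card (window d p i) = d"
        using p i card_window[of d p i] by (auto simp: sparse_words_def I_def)
      then have "card (Q (window d p i)) \<le> d * n * fact d"
        unfolding Q_def using d by (intro card_distinct_lists_near_set) auto
      then show "card ((@) p ` Q (window d p i)) \<le> d * n * fact d"
        using card_image_le[OF finQ] order_trans by blast
    qed
    also have "\<dots> = card (?A (Suc m - d)) * card I * (d * n * fact d)"
      by (simp add: card_cartesian_product)
    also have "\<dots> \<le> card (?A (Suc m - d)) * m * (d * n * fact d)"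
    proof -
      have "I \<subseteq> {..<m}" using d by (auto simp: I_def)
      then have "card I \<le> m" using card_mono[of "{..<m}" I] by simp
      then show ?thesis by (intro mult_le_mono) auto
    qed
    finally show ?thesis using True by (simp add: mult_ac)
  next
    case False
    then have "I = {}" by (auto simp: I_def)
    then show ?thesis by (simp add: B2_def)
  qed
  ultimately show ?thesis by linarith
qed

text \<open>
  Rosenfeld's counting argument: the growth rate \<open>\<beta>\<close> for shorter words bounds the number of
  prefixes onto which a conflicting last window can be appended, and this sustains the rate.
\<close>

lemma card_sparse_words_growth:
  fixes \<beta> :: real
  assumes d: "d \<ge> 1" and \<beta>: "\<beta> > 0"
    and bound: "\<beta> + 2 * real d + real N * (real d * real n * fact d) / \<beta> ^ (d - 1) \<le> real n"
    and "m \<le> N"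
  shows "\<beta> * real (card (sparse_words n d m)) \<le> real (card (sparse_words n d (Suc m)))"
  using \<open>m \<le> N\<close>
proof (induction m rule: less_induct)
  case (less m)
  define a where "a k = real (card (sparse_words n d k))" for k
  define C where "C = real d * real n * fact d"
  have a_nonneg: "a k \<ge> 0" for k by (simp add: a_def)
  have C_nonneg: "C \<ge> 0" by (simp add: C_def)
  have step: "\<beta> * a k \<le> a (Suc k)" if "k < m" for k
    using less.IH[of k] less.prems that by (simp add: a_def)
  \<comment> \<open>The growth rate, iterated backwards from \<open>m\<close>, bounds the counts of
    shorter words in terms of \<open>a m\<close>.\<close>
  have pow: "\<beta> ^ k * a (m - k) \<le> a m" if "k \<le> m" for k
    using that
  proof (induction k)
    case (Suc k)
    have "\<beta> ^ Suc k * a (m - Suc k) = \<beta> ^ k * (\<beta> * a (m - Suc k))" by simp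
    also have "\<dots> \<le> \<beta> ^ k * a (m - k)"
      using step[of "m - Suc k"] Suc.prems \<beta> by (intro mult_left_mono) (auto simp: Suc_diff_Suc)
    also have "\<dots> \<le> a m" using Suc by simp
    finally show ?case .
  qed simp
  have "real n * a m \<le> a (Suc m) + 2 * real d * a m +
      (if 2 * d \<le> Suc m then real m * C * a (Suc m - d) else 0)"
    using card_sparse_words_step[OF d, of n m]
    unfolding a_def C_def of_nat_le_iff[where 'a = real, symmetric]
    by (simp split: if_splits)
  also have "(if 2 * d \<le> Suc m then real m * C * a (Suc m - d) else 0)
      \<le> real N * C * (a m / \<beta> ^ (d - 1))"
  proof (cases "2 * d \<le> Suc m")
    case True
    \<comment> \<open>Relative to length \<open>m\<close>, the prefix is only \<open>d - 1\<close>
      letters shorter, which gives the exponent of \<open>\<beta>\<close>.\<close>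
    have "Suc m - d = m - (d - 1)" using d by simp
    then have "a (Suc m - d) \<le> a m / \<beta> ^ (d - 1)"
      using pow[of "d - 1"] True d \<beta> by (simp add: field_simps)
    then show ?thesis
      using True less.prems a_nonneg C_nonneg
      by (simp del: times_divide_eq_right) (intro mult_mono; simp)
  next
    case False
    then show ?thesis using a_nonneg C_nonneg \<beta> by simp
  qed
  finally have "real n * a m \<le> a (Suc m) + (2 * real d + real N * C / \<beta> ^ (d - 1)) * a m"
    by (simp add: algebra_simps)
  moreover have "(\<beta> + (2 * real d + real N * C / \<beta> ^ (d - 1))) * a m \<le> real n * a m"
    using bound a_nonneg by (intro mult_right_mono) (auto simp: C_def)
  ultimately have "\<beta> * a m \<le> a (Suc m)"
    by (simp add: algebra_simps)
  then show ?case by (simp add: a_def)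
qed

text \<open>The empty word is sparse, and each further count is at least a positive multiple of the
  previous one.\<close>

lemma sparse_words_nonempty:
  fixes \<beta> :: real
  assumes d: "d \<ge> 1" and \<beta>: "\<beta> > 0"
    and bound: "\<beta> + 2 * real d + real N * (real d * real n * fact d) / \<beta> ^ (d - 1) \<le> real n"
  shows "sparse_words n d N \<noteq> {}"
proof -
  have "real (card (sparse_words n d m)) > 0" if "m \<le> N" for m
    using that
  proof (induction m)
    case 0
    have "[] \<in> sparse_words n d 0"
      using d by (simp add: sparse_words_def sparse_word_def)
    then show ?case using finite_sparse_words by (auto simp: card_gt_0_iff)
  next
    case (Suc m)
    then have "0 < \<beta> * real (card (sparse_words n d m))" using \<beta> by simp
    also have "\<dots> \<le> real (card (sparse_words n d (Suc m)))"
      using Suc.prems by (intro card_sparse_words_growth[OF d \<beta> bound]) simp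
    finally show ?case .
  qed
  then show ?thesis by fastforce
qed

text \<open>With \<open>k = d - 1\<close> the base is the inverse of \<open>1 + 1 / k\<close>, and
  \<open>1 + 1 / k \<le> exp (1 / k)\<close>.\<close>

lemma exp_minus_one_le_power:
  assumes "d \<ge> 2"
  shows "exp (- 1) \<le> (1 - 1 / real d) ^ (d - 1)"
proof -
  define k where "k = real d - 1"
  have k: "k > 0" "real (d - 1) = k" "real d = k + 1"
    using assms by (auto simp: k_def)
  have inv: "1 - 1 / real d = inverse (1 + 1 / k)"
    using k by (simp add: field_simps)
  have "(1 + 1 / k) ^ (d - 1) \<le> exp (1 / k) ^ (d - 1)"
    using k by (intro power_mono exp_ge_add_one_self) auto
  also have "\<dots> = exp 1"
    using k by (simp flip: exp_of_nat_mult)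
  finally have "inverse (exp 1) \<le> inverse ((1 + 1 / k) ^ (d - 1))"
    using k by (intro le_imp_inverse_le) (auto intro!: zero_less_power add_pos_pos)
  then show ?thesis
    by (simp add: inv exp_minus power_inverse)
qed

text \<open>The rate \<open>\<beta> = n * (1 - 1 / d)\<close> leaves a slack of
  \<open>n / d\<close>. One half of it covers \<open>2 * d\<close>, by
  \<open>n \<ge> 4 * d ^ 2\<close>; the other half covers the conflicting windows, by the bound on
  \<open>N\<close> and \<open>\<beta> ^ (d - 1) \<ge> n ^ (d - 1) / e\<close>.\<close>

lemma exists_long_sparse_word:
  assumes d: "d \<ge> 2" and n: "n \<ge> 4 * d ^ 2"
    and N: "real N \<le> real n ^ (d - 1) / (2 * exp 1 * real d ^ 2 * fact d)"
  shows "sparse_words n d N \<noteq> {}"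
proof (rule sparse_words_nonempty)
  define \<beta> where "\<beta> = real n * (1 - 1 / real d)"
  have n0: "real n > 0" using n d by (cases n) auto
  show "\<beta> > 0" using n0 d by (simp add: \<beta>_def)
  have "real n ^ (d - 1) / exp 1 = real n ^ (d - 1) * exp (- 1)"
    by (simp add: exp_minus field_simps)
  also have "\<dots> \<le> real n ^ (d - 1) * (1 - 1 / real d) ^ (d - 1)"
    using exp_minus_one_le_power[OF d] by (intro mult_left_mono) auto
  also have "\<dots> = \<beta> ^ (d - 1)"
    by (simp add: \<beta>_def power_mult_distrib)
  finally have pow: "real n ^ (d - 1) / exp 1 \<le> \<beta> ^ (d - 1)" .
  have "real N * (real d * real n * fact d) / \<beta> ^ (d - 1)
      \<le> (real n ^ (d - 1) / (2 * exp 1 * real d ^ 2 * fact d)) * (real d * real n * fact d)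
        / (real n ^ (d - 1) / exp 1)"
    using N pow n0 by (intro frac_le mult_right_mono) auto
  also have "\<dots> = real n / (2 * real d)"
    using n0 d by (simp add: field_simps power2_eq_square)
  finally have "real N * (real d * real n * fact d) / \<beta> ^ (d - 1) \<le> real n / (2 * real d)" .
  moreover have "2 * real d \<le> real n / (2 * real d)"
  proof -
    have "real (4 * d ^ 2) \<le> real n" using n by (rule of_nat_mono)
    then show ?thesis using d by (simp add: field_simps power2_eq_square)
  qed
  moreover have "\<beta> = real n - 2 * (real n / (2 * real d))"
    using d by (simp add: \<beta>_def field_simps)
  ultimately show "\<beta> + 2 * real d + real N * (real d * real n * fact d) / \<beta> ^ (d - 1) \<le> real n"
    by linarith
qed (use d in simp)

subsection \<open>Bounds for the maximal diameter\<close>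

lemma combinatorial_diameter_bound:
  assumes "admissible n d K" and "d \<ge> 2"
  shows "real (combinatorial_diameter K) * fact d / real n ^ (d - 1) \<le> real d / (real d - 1)"
proof (cases "n = 0")
  case True
  \<comment> \<open>Here \<open>0 ^ (d - 1) = 0\<close>, and division by zero yields 0.\<close>
  then show ?thesis using assms(2) by (simp add: power_0_left)
next
  case False
  let ?D = "combinatorial_diameter K"
  have "?D * (d - 1) * fact (d - 1) \<le> (n choose (d - 1)) * fact (d - 1)"
    using combinatorial_diameter_le_binomial[OF assms(1)] assms(2) by (intro mult_right_mono) auto
  also have "\<dots> \<le> n ^ (d - 1)" by (rule binomial_fact_pow)
  finally have "real (?D * (d - 1) * fact (d - 1)) \<le> real (n ^ (d - 1))"
    by (rule of_nat_mono)
  then have *: "real ?D * (real d - 1) * fact (d - 1) \<le> real n ^ (d - 1)"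
    using assms(2) by (simp add: of_nat_diff)
  have "fact d = real d * fact (d - 1)"
    using assms(2) by (simp add: fact_reduce)
  then have "real ?D * fact d * (real d - 1) \<le> real d * real n ^ (d - 1)"
    using mult_left_mono[OF *, of "real d"] by (simp add: mult_ac)
  then show ?thesis
    using False assms(2) by (simp add: field_simps)
qed

text \<open>Infinitely many complexes on natural numbers compete in \<open>H_s\<close>, but their
  diameters are bounded, so the maximum is well behaved.\<close>

lemma finite_admissible_diameters:
  assumes "d \<ge> 2"
  shows "finite {combinatorial_diameter K | K. admissible n d K}"
proof (rule finite_subset)
  show "{combinatorial_diameter K | K. admissible n d K} \<subseteq> {..n choose (d - 1)}"
  proof
    fix x assume "x \<in> {combinatorial_diameter K | K. admissible n d K}"
    then obtain K where K: "admissible n d K" and x: "x = combinatorial_diameter K" by blast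
    have "x * 1 \<le> x * (d - 1)"
      using assms by (intro mult_le_mono2) simp
    also have "\<dots> \<le> n choose (d - 1)"
      unfolding x using combinatorial_diameter_le_binomial[OF K] assms by simp
    finally show "x \<in> {..n choose (d - 1)}" by simp
  qed
qed simp

lemma H_s_upper:
  assumes d: "d \<ge> 2" and n: "n \<ge> d"
  shows "real (H_s n d) * fact d / real n ^ (d - 1) \<le> real d / (real d - 1)"
proof -
  \<comment> \<open>A word with a single window shows that some admissible complex exists, so that
    \<open>Max\<close> is attained.\<close>
  have "sparse_word d [0..<d]"
    using d by (auto simp: sparse_word_def)
  then obtain K where "admissible n d K"
    using sparse_word_diameter[of d "[0..<d]" n] d n by (auto simp: atLeast0LessThan)
  then have "{combinatorial_diameter K | K. admissible n d K} \<noteq> {}" by blast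
  then have "H_s n d \<in> {combinatorial_diameter K | K. admissible n d K}"
    unfolding H_s_def using finite_admissible_diameters[OF d] by (intro Max_in)
  then show ?thesis using combinatorial_diameter_bound d by auto
qed

lemma H_s_ge_length:
  assumes "w \<in> sparse_words n d N" and d: "d \<ge> 2" and "d \<le> N"
  shows "N - d \<le> H_s n d"
proof -
  obtain K where K: "admissible n d K" "N - d \<le> combinatorial_diameter K"
    using sparse_word_diameter[of d w n] assms by (auto simp: sparse_words_def)
  have "combinatorial_diameter K \<le> H_s n d"
    unfolding H_s_def using K(1) by (intro Max_ge finite_admissible_diameters[OF d]) blast
  with K(2) show ?thesis by linarith
qed

text \<open>Rounding \<open>y\<close> down costs less than 1, and a word of length \<open>N\<close>
  gives a path of length \<open>N - d\<close>. The total loss is at most \<open>y / 2\<close> as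
  soon as \<open>y \<ge> 2 * d + 2\<close>; this halving turns \<open>2 * e\<close> into
  \<open>4 * e\<close>.\<close>

lemma H_s_lower:
  assumes d: "d \<ge> 2" and n: "n \<ge> 4 * d ^ 2"
    and large: "real n \<ge> 2 * (real d + 1) * (2 * exp 1 * real d ^ 2 * fact d)"
  shows "1 / (4 * exp 1 * real d ^ 2) \<le> real (H_s n d) * fact d / real n ^ (d - 1)"
proof -
  define y where "y = real n ^ (d - 1) / (2 * exp 1 * real d ^ 2 * fact d)"
  define N where "N = nat \<lfloor>y\<rfloor>"
  have n1: "real n \<ge> 1" using n d by (cases n) auto
  have y0: "y \<ge> 0" by (simp add: y_def)
  have "real n = real n ^ 1" by simp
  also have "\<dots> \<le> real n ^ (d - 1)" using n1 d by (intro power_increasing) auto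
  finally have "2 * (real d + 1) * (2 * exp 1 * real d ^ 2 * fact d) \<le> real n ^ (d - 1)"
    using large by linarith
  then have "2 * (real d + 1) \<le> y"
    unfolding y_def using d by (subst le_divide_eq) auto
  then have y: "2 * real d + 2 \<le> y" by simp
  have Ny: "real N \<le> y" "y < real N + 1"
    using y0 by (auto simp: N_def)
  then have "real d \<le> real N" using y by linarith
  then have "d \<le> N" by simp
  obtain w where "w \<in> sparse_words n d N"
    using exists_long_sparse_word[OF d n, of N] Ny by (auto simp: y_def)
  then have "N - d \<le> H_s n d"
    using d \<open>d \<le> N\<close> by (rule H_s_ge_length)
  then have "real N - real d \<le> real (H_s n d)"
    by linarith
  then have "y / 2 \<le> real (H_s n d)"
    using Ny y by linarith
  then have "y / 2 * fact d / real n ^ (d - 1) \<le> real (H_s n d) * fact d / real n ^ (d - 1)"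
    by (intro divide_right_mono mult_right_mono) auto
  moreover have "y / 2 * fact d / real n ^ (d - 1) = 1 / (4 * exp 1 * real d ^ 2)"
    using n1 d by (simp add: y_def field_simps)
  ultimately show ?thesis by simp
qed

theorem theorem2:
  fixes d :: nat
  assumes "d \<ge> 3"
  shows "\<exists>\<epsilon> :: nat \<Rightarrow> real. \<epsilon> \<longlonglongrightarrow> 0 \<and>
    (\<forall>n\<ge>d.
       (1 - \<epsilon> n) * (1 / (4 * exp 1 * real d ^ 2)) \<le> real (H_s n d) * fact d / real n ^ (d - 1) \<and>
       real (H_s n d) * fact d / real n ^ (d - 1) \<le> real d / (real d - 1))"
proof -
  define n0 where
    "n0 = max (4 * d ^ 2) (nat \<lceil>2 * (real d + 1) * (2 * exp 1 * real d ^ 2 * fact d)\<rceil>)"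
  \<comment> \<open>Below the threshold the value 1 makes the lower bound 0, hence trivial; from
    \<open>n0\<close> on the bound holds without error.\<close>
  define \<epsilon> :: "nat \<Rightarrow> real" where "\<epsilon> n = (if n \<ge> n0 then 0 else 1)" for n
  have d: "d \<ge> 2" using assms by simp
  have "\<epsilon> \<longlonglongrightarrow> 0"
    by (rule tendsto_eventually) (auto simp: \<epsilon>_def eventually_sequentially)
  moreover have "(1 - \<epsilon> n) * (1 / (4 * exp 1 * real d ^ 2))
      \<le> real (H_s n d) * fact d / real n ^ (d - 1)" for n
  proof (cases "n \<ge> n0")
    case True
    then have "n \<ge> 4 * d ^ 2"
      and "real n \<ge> 2 * (real d + 1) * (2 * exp 1 * real d ^ 2 * fact d)"
      by (auto simp: n0_def nat_le_iff ceiling_le_iff)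
    then show ?thesis using H_s_lower[OF d] True by (simp add: \<epsilon>_def)
  qed (simp add: \<epsilon>_def)
  ultimately show ?thesis
    using H_s_upper[OF d] by blast
qed

end
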